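(* For all positive integers $k$ and $n$, the edgeless graph $\bar{K}_n$ on $n$ vertices satisfies $$P_{\ell}^u (\bar{K}_n, k) = P^u (\bar{K}_n, k) = \binom{k + n - 1}{n}.$$
   Context: All graphs are nonempty, finite and simple. A proper $k$-coloring of a graph $G$ is a map $f : V(G) \to \{1, \ldots, k\}$ such that adjacent vertices receive different values. Two colorings $f, g$ of $G$ are equivalent up to labeling if there is an automorphism $\pi$ of $G$ such that $f(v) = g(\pi(v))$ for all $v \in V(G)$. $P^u(G,k)$ denotes the number of equivalence classes of proper $k$-colorings of $G$ under this relation. A $k$-assignment $L$ for $G$ assigns to each vertex $v \in V(G)$ a set $L(v)$ of exactly $k$ available colors (there is no restriction on which colors are used, and different vertices may have different lists). A proper $L$-coloring of $G$ is a map $f$ on $V(G)$ with $f(v) \in L(v)$ for every $v \in V(G)$ and $f(u) \ne f(v)$ whenever $u, v$ are adjacent. $P^u(G, L)$ denotes the number of equivalence classes of proper $L$-colorings of $G$, where two proper $L$-colorings $f, g$ are equivalent if $f = g \circ \pi$ for some automorphism $\pi$ of $G$. The unlabeled list color function $P^u_{\ell}(G, k)$ is the minimum of $P^u(G, L)$ over all $k$-assignments $L$ for $G$. *)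

theory Defs
  imports "Graph_Theory.Pair_Digraph" "Graph_Theory.Digraph_Isomorphism" "HOL-Library.FuncSet"
begin

text \<open>
  A finite simple graph is a \<^locale>\<open>pair_graph\<close>: a finite vertex set \<^const>\<open>pverts\<close> with a
  symmetric irreflexive adjacency relation \<^const>\<open>parcs\<close> on it.
\<close>

definition edgeless_graph :: "'a set \<Rightarrow> 'a pair_pre_digraph" where
  "edgeless_graph V = \<lparr> pverts = V, parcs = {} \<rparr>"

definition graph_automorphism :: "'a pair_pre_digraph \<Rightarrow> ('a \<Rightarrow> 'a) \<Rightarrow> bool" where
  "graph_automorphism G \<pi> \<longleftrightarrow>
     bij_betw \<pi> (pverts G) (pverts G) \<and>
     (\<forall>u\<in>pverts G. \<forall>v\<in>pverts G. (u, v) \<in> parcs G \<longleftrightarrow> (\<pi> u, \<pi> v) \<in> parcs G)"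

text \<open>
  Colorings are extensional functions (\<^const>\<open>undefined\<close> outside the vertex set), so that two
  colorings are equal exactly when they agree on all vertices.
\<close>

definition proper_list_colorings ::
    "'a pair_pre_digraph \<Rightarrow> ('a \<Rightarrow> 'c set) \<Rightarrow> ('a \<Rightarrow> 'c) set" where
  "proper_list_colorings G L =
     {f \<in> (\<Pi>\<^sub>E v\<in>pverts G. L v). \<forall>(u, v)\<in>parcs G. f u \<noteq> f v}"

definition coloring_equiv ::
    "'a pair_pre_digraph \<Rightarrow> ('a \<Rightarrow> 'c set) \<Rightarrow> (('a \<Rightarrow> 'c) \<times> ('a \<Rightarrow> 'c)) set" where
  "coloring_equiv G L =
     {(f, g). f \<in> proper_list_colorings G L \<and> g \<in> proper_list_colorings G L \<and>
              (\<exists>\<pi>. graph_automorphism G \<pi> \<and> (\<forall>v\<in>pverts G. f v = g (\<pi> v)))}"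

definition unlabeled_list_colorings :: "'a pair_pre_digraph \<Rightarrow> ('a \<Rightarrow> 'c set) \<Rightarrow> nat" where
  "unlabeled_list_colorings G L = card (proper_list_colorings G L // coloring_equiv G L)"

definition unlabeled_colorings :: "'a pair_pre_digraph \<Rightarrow> nat \<Rightarrow> nat" where
  "unlabeled_colorings G k = unlabeled_list_colorings G (\<lambda>_. {1..k})"

definition k_assignment :: "'a pair_pre_digraph \<Rightarrow> nat \<Rightarrow> ('a \<Rightarrow> 'c set) \<Rightarrow> bool" where
  "k_assignment G k L \<longleftrightarrow> (\<forall>v\<in>pverts G. finite (L v) \<and> card (L v) = k)"

text \<open>
  The lists range over arbitrary sets of natural numbers. As only finitely many colors occur in a
  list assignment of a finite graph, this loses no generality over an arbitrary stock of colors.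
\<close>

definition unlabeled_list_color_function :: "'a pair_pre_digraph \<Rightarrow> nat \<Rightarrow> nat" where
  "unlabeled_list_color_function G k =
     (LEAST m. \<exists>L :: 'a \<Rightarrow> nat set. k_assignment G k L \<and> m = unlabeled_list_colorings G L)"

lemma pair_graph_edgeless_graph: "finite V \<Longrightarrow> pair_graph (edgeless_graph V)"
  by unfold_locales (auto simp: edgeless_graph_def symmetric_def)

lemma graph_automorphism_iff_digraph_isomorphism:
  assumes "pair_graph G"
  shows "graph_automorphism G \<pi> \<longleftrightarrow>
    (\<exists>h. pre_digraph.digraph_isomorphism (with_proj G) h \<and> app_iso h (with_proj G) = with_proj G \<and>
         iso_verts h = \<pi>)" (is "_ \<longleftrightarrow> ?R")
proof
  interpret pair_graph G by fact
  assume a: "graph_automorphism G \<pi>"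
  let ?h = "\<lparr>iso_verts = \<pi>, iso_arcs = map_prod \<pi> \<pi>, iso_head = snd, iso_tail = fst\<rparr>"
  have inj: "inj_on \<pi> (pverts G)" and im: "\<pi> ` pverts G = pverts G"
    using a by (auto simp: graph_automorphism_def bij_betw_def)
  have injA: "inj_on (map_prod \<pi> \<pi>) (parcs G)"
    by (rule inj_on_subset[OF map_prod_inj_on[OF inj inj]]) (auto dest: in_arcsD1 in_arcsD2)
  have "map_prod \<pi> \<pi> ` parcs G = parcs G"
  proof
    show "map_prod \<pi> \<pi> ` parcs G \<subseteq> parcs G"
      using a by (auto simp: graph_automorphism_def dest: in_arcsD1 in_arcsD2)
    show "parcs G \<subseteq> map_prod \<pi> \<pi> ` parcs G"
    proof
      fix e assume e: "e \<in> parcs G"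
      obtain x y where xy: "e = (x, y)" by (cases e)
      have "x \<in> \<pi> ` pverts G" "y \<in> \<pi> ` pverts G"
        using e xy im in_arcsD1 in_arcsD2 by auto
      then obtain u v where uv: "u \<in> pverts G" "v \<in> pverts G" "x = \<pi> u" "y = \<pi> v" by auto
      then have "(u, v) \<in> parcs G" using a e xy by (auto simp: graph_automorphism_def)
      then show "e \<in> map_prod \<pi> \<pi> ` parcs G" using xy uv by (auto intro: rev_image_eqI)
    qed
  qed
  then have "app_iso ?h (with_proj G) = with_proj G"
    using im by (auto simp: app_iso_def with_proj_def)
  moreover have "pre_digraph.digraph_isomorphism (with_proj G) ?h"
    using inj injA wf_digraph
    by (auto simp: pre_digraph.digraph_isomorphism_def)
  ultimately show ?R by (intro exI[of _ ?h]) simp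
next
  interpret pair_graph G by fact
  assume ?R
  then obtain h where h: "pre_digraph.digraph_isomorphism (with_proj G) h"
    and app: "app_iso h (with_proj G) = with_proj G" and pi: "iso_verts h = \<pi>" by auto
  have inj: "inj_on \<pi> (pverts G)" using h pi by (auto simp: pre_digraph.digraph_isomorphism_def)
  from app pi have im: "\<pi> ` pverts G = pverts G" and imA: "iso_arcs h ` parcs G = parcs G"
    and ht: "iso_tail h = fst" "iso_head h = snd"
    by (auto simp: app_iso_def with_proj_def)
  have arc: "iso_arcs h (u, v) = (\<pi> u, \<pi> v)" if "(u, v) \<in> parcs G" for u v
    using h that ht pi by (auto simp: pre_digraph.digraph_isomorphism_def prod_eq_iff)
  have "(u, v) \<in> parcs G"
    if uv: "u \<in> pverts G" "v \<in> pverts G" and e: "(\<pi> u, \<pi> v) \<in> parcs G" for u v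
  proof -
    from e imA obtain e' where "e' \<in> parcs G" "iso_arcs h e' = (\<pi> u, \<pi> v)"
      by (metis imageE)
    then obtain x y where xy: "(x, y) \<in> parcs G" "iso_arcs h (x, y) = (\<pi> u, \<pi> v)"
      by (cases e') auto
    then have "\<pi> x = \<pi> u" "\<pi> y = \<pi> v" using arc by auto
    then have "x = u" "y = v" using inj uv xy in_arcsD1 in_arcsD2 by (auto dest: inj_onD)
    then show ?thesis using xy by simp
  qed
  moreover have "(\<pi> u, \<pi> v) \<in> parcs G" if "(u, v) \<in> parcs G" for u v
    using imA arc[OF that] that by (metis imageI)
  ultimately show "graph_automorphism G \<pi>"
    using inj im by (auto simp: graph_automorphism_def bij_betw_def)
qed

lemma equiv_coloring_equiv: "equiv (proper_list_colorings G L) (coloring_equiv G L)"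
proof (rule equivI)
  show "coloring_equiv G L \<subseteq> proper_list_colorings G L \<times> proper_list_colorings G L"
    by (auto simp: coloring_equiv_def)
  have "graph_automorphism G id" by (simp add: graph_automorphism_def)
  then show "refl_on (proper_list_colorings G L) (coloring_equiv G L)"
    by (auto simp: refl_on_def coloring_equiv_def intro!: exI[of _ id])
  show "sym (coloring_equiv G L)"
  proof (rule symI)
    fix f g assume fg: "(f, g) \<in> coloring_equiv G L"
    then obtain \<pi> where a: "graph_automorphism G \<pi>" and e: "\<forall>v\<in>pverts G. f v = g (\<pi> v)"
      by (auto simp: coloring_equiv_def)
    let ?s = "inv_into (pverts G) \<pi>"
    have b: "bij_betw \<pi> (pverts G) (pverts G)" using a by (simp add: graph_automorphism_def)
    have s: "bij_betw ?s (pverts G) (pverts G)" by (rule bij_betw_inv_into[OF b])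
    have in_s: "?s v \<in> pverts G" "\<pi> (?s v) = v" if "v \<in> pverts G" for v
      using that bij_betwE[OF s] bij_betw_inv_into_right[OF b] by auto
    have "(u, v) \<in> parcs G \<longleftrightarrow> (?s u, ?s v) \<in> parcs G"
      if "u \<in> pverts G" "v \<in> pverts G" for u v
      using a in_s[OF that(1)] in_s[OF that(2)] unfolding graph_automorphism_def by metis
    then have "graph_automorphism G ?s" using s by (auto simp: graph_automorphism_def)
    moreover have "\<forall>v\<in>pverts G. g v = f (?s v)" using e in_s by simp
    ultimately show "(g, f) \<in> coloring_equiv G L" using fg by (auto simp: coloring_equiv_def)
  qed
  show "trans (coloring_equiv G L)"
  proof (rule transI)
    fix f g h assume fg: "(f, g) \<in> coloring_equiv G L" and gh: "(g, h) \<in> coloring_equiv G L"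
    obtain \<pi> \<sigma> where p: "graph_automorphism G \<pi>" "\<forall>v\<in>pverts G. f v = g (\<pi> v)"
      and s: "graph_automorphism G \<sigma>" "\<forall>v\<in>pverts G. g v = h (\<sigma> v)"
      using fg gh by (auto simp: coloring_equiv_def)
    have in_p: "\<pi> v \<in> pverts G" if "v \<in> pverts G" for v
      using p(1) that by (auto simp: graph_automorphism_def dest: bij_betwE)
    have "graph_automorphism G (\<sigma> \<circ> \<pi>)"
      unfolding graph_automorphism_def
    proof (intro conjI ballI)
      show "bij_betw (\<sigma> \<circ> \<pi>) (pverts G) (pverts G)"
        using p(1) s(1) unfolding graph_automorphism_def by (blast intro: bij_betw_trans)
      fix u v assume uv: "u \<in> pverts G" "v \<in> pverts G"
      have "(u, v) \<in> parcs G \<longleftrightarrow> (\<pi> u, \<pi> v) \<in> parcs G"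
        using p(1) uv unfolding graph_automorphism_def by blast
      also have "\<dots> \<longleftrightarrow> (\<sigma> (\<pi> u), \<sigma> (\<pi> v)) \<in> parcs G"
        using s(1) in_p uv unfolding graph_automorphism_def by blast
      finally show "(u, v) \<in> parcs G \<longleftrightarrow> ((\<sigma> \<circ> \<pi>) u, (\<sigma> \<circ> \<pi>) v) \<in> parcs G" by simp
    qed
    moreover have "\<forall>v\<in>pverts G. f v = h ((\<sigma> \<circ> \<pi>) v)" using p(2) s(2) in_p by simp
    ultimately show "(f, h) \<in> coloring_equiv G L"
      using fg gh unfolding coloring_equiv_def by blast
  qed
qed

lemma unlabeled_list_color_function_attained:
  "\<exists>L :: 'a \<Rightarrow> nat set. k_assignment G k L \<and>
     unlabeled_list_color_function G k = unlabeled_list_colorings G L"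
proof -
  have "k_assignment G k (\<lambda>_. {1..k})" by (simp add: k_assignment_def)
  then have "\<exists>m. \<exists>L :: 'a \<Rightarrow> nat set. k_assignment G k L \<and> m = unlabeled_list_colorings G L"
    by blast
  from LeastI_ex[OF this] show ?thesis unfolding unlabeled_list_color_function_def .
qed

end

theory Submission
  imports Defs "HOL-Library.Multiset" "HOL-Combinatorics.Permutations"
begin

text \<open>
  Every permutation of the vertices is an automorphism of an edgeless graph, so a class of
  colorings is determined by how often each color is used: classes correspond to the multisets
  \<open>{#f v. v \<in> V#}\<close> with \<open>f v \<in> L v\<close>. If all lists equal one set of size \<open>k\<close>, these are all
  multisets of size \<open>n\<close> over a \<open>k\<close>-element set, and there are \<open>(k + n - 1) choose n\<close> of them.

  It remains to see that no other lists of size \<open>k\<close> yield fewer multisets. The argument follows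
  Pascal's rule. Take a vertex \<open>v\<close> and a color \<open>c \<in> L v\<close>. The multisets that avoid \<open>c\<close> include
  those from the lists \<open>L w - {c}\<close>, each of size at least \<open>k - 1\<close>; the multisets that contain \<open>c\<close>
  include those that color \<open>v\<close> with \<open>c\<close> and the other \<open>n - 1\<close> vertices arbitrarily. By
  induction, there are at least \<open>(k + n - 2) choose n\<close> of the former and at least
  \<open>(k + n - 2) choose (n - 1)\<close> of the latter. This is \<open>card_color_multisets_ge\<close>.
\<close>

definition color_multisets :: "'a set \<Rightarrow> ('a \<Rightarrow> 'c set) \<Rightarrow> 'c multiset set" where
  "color_multisets V L = (\<lambda>f. image_mset f (mset_set V)) ` (\<Pi>\<^sub>E v\<in>V. L v)"

lemma finite_color_multisets:
  assumes "finite V" and "\<And>v. v \<in> V \<Longrightarrow> finite (L v)"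
  shows "finite (color_multisets V L)"
  unfolding color_multisets_def by (intro finite_imageI finite_PiE assms)

lemma color_multisets_mono:
  assumes "\<And>v. v \<in> V \<Longrightarrow> L v \<subseteq> L' v"
  shows "color_multisets V L \<subseteq> color_multisets V L'"
  unfolding color_multisets_def by (intro image_mono PiE_mono assms)

lemma color_multisets_insert:
  assumes "finite W" and "v \<notin> W"
  shows "color_multisets (insert v W) L = (\<lambda>(c, M). add_mset c M) ` (L v \<times> color_multisets W L)"
proof -
  have "image_mset (f(v := c)) (mset_set (insert v W)) = add_mset c (image_mset f (mset_set W))"
    for f :: "'a \<Rightarrow> 'b" and c
    using assms by (auto intro!: image_mset_cong)
  then show ?thesis
    unfolding color_multisets_def PiE_insert_eq image_image
    by (force simp: image_iff)
qed

lemma color_multisets_const: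
  assumes "finite V"
  shows "color_multisets V (\<lambda>_. C) = multisets_of_size C (card V)"
  using assms
proof (induction V rule: finite_induct)
  case empty
  then show ?case by (simp add: color_multisets_def)
next
  case (insert v W)
  have "(\<lambda>(c, M). add_mset c M) ` (C \<times> multisets_of_size C (card W))
      = multisets_of_size C (Suc (card W))" (is "?l = ?r")
  proof
    show "?l \<subseteq> ?r" by (auto simp: multisets_of_size_def)
    show "?r \<subseteq> ?l"
    proof
      fix M assume M: "M \<in> ?r"
      then have "size M = Suc (card W)" by (simp add: multisets_of_size_def)
      then obtain c N where "M = add_mset c N" by (auto dest: size_eq_Suc_imp_eq_union)
      with M show "M \<in> ?l" by (force simp: multisets_of_size_def)
    qed
  qed
  with insert show ?case by (simp add: color_multisets_insert)
qed

text \<open>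
  Lists of size at least \<open>k\<close>, rather than exactly \<open>k\<close>, keep the induction going: deleting the
  color \<open>c\<close> shrinks only those lists that contain it.
\<close>

lemma card_color_multisets_ge:
  assumes "finite V" and "card V = n" and "\<And>v. v \<in> V \<Longrightarrow> finite (L v) \<and> k \<le> card (L v)"
  shows "(k + n - 1) choose n \<le> card (color_multisets V L)"
  using assms
proof (induction n arbitrary: V L k)
  case 0
  then show ?case by (simp add: color_multisets_def)
next
  case (Suc m)
  note smaller_vertex_set = Suc.IH
  show ?case
    using Suc.prems
  proof (induction k arbitrary: L)
    case 0
    show ?case by (simp add: binomial_eq_0)
  next
    case (Suc j)
    obtain v W where V: "V = insert v W" "v \<notin> W" "card W = m"
      using Suc.prems(2) by (auto simp: card_Suc_eq)
    have W: "finite W" using Suc.prems(1) V(1) by simp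
    have "finite (L v)" "Suc j \<le> card (L v)" using Suc.prems(3) V(1) by auto
    then obtain c where c: "c \<in> L v" by fastforce
    define A where "A = color_multisets V (\<lambda>w. L w - {c})"
    define B where "B = add_mset c ` color_multisets W L"
    have fin: "finite (color_multisets V L)"
      using Suc.prems by (intro finite_color_multisets) auto
    have "A \<subseteq> color_multisets V L"
      unfolding A_def by (rule color_multisets_mono) auto
    moreover have "B \<subseteq> color_multisets V L"
      using c unfolding B_def V(1) color_multisets_insert[OF W V(2)] by auto
    ultimately have sub: "A \<union> B \<subseteq> color_multisets V L" by blast
    have "c \<notin># M" if "M \<in> A" for M
      using that Suc.prems(1) by (auto simp: A_def color_multisets_def)
    moreover have "c \<in># M" if "M \<in> B" for M
      using that by (auto simp: B_def)
    ultimately have disj: "A \<inter> B = {}" by blast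
    have "(j + Suc m - 1) choose Suc m \<le> card A"
      unfolding A_def
    proof (rule Suc.IH)
      fix w assume "w \<in> V"
      then have "finite (L w)" "Suc j \<le> card (L w)" using Suc.prems(3) by auto
      then show "finite (L w - {c}) \<and> j \<le> card (L w - {c})"
        by (auto simp: card_Diff_singleton_if)
    qed (use Suc.prems in auto)
    moreover have "(Suc j + m - 1) choose m \<le> card B"
    proof -
      have "(Suc j + m - 1) choose m \<le> card (color_multisets W L)"
        using W V Suc.prems(3) by (intro smaller_vertex_set) auto
      also have "\<dots> = card B"
        unfolding B_def by (rule card_image[symmetric]) (simp add: inj_on_def)
      finally show ?thesis .
    qed
    ultimately have "(Suc j + Suc m - 1) choose Suc m \<le> card A + card B" by simp
    also have "\<dots> = card (A \<union> B)"
      using disj finite_subset[OF sub fin] by (simp add: card_Un_disjoint)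
    also have "\<dots> \<le> card (color_multisets V L)" by (rule card_mono[OF fin sub])
    finally show ?case .
  qed
qed

lemma proper_list_colorings_edgeless:
  "proper_list_colorings (edgeless_graph V) L = (\<Pi>\<^sub>E v\<in>V. L v)"
  by (simp add: proper_list_colorings_def edgeless_graph_def)

text \<open>
  Two maps on a finite set have the same multiset of values exactly when they differ by a
  permutation of the set, and on an edgeless graph the permutations are the automorphisms.
\<close>

lemma coloring_equiv_edgeless_iff:
  assumes "finite V"
  shows "(f, g) \<in> coloring_equiv (edgeless_graph V) L \<longleftrightarrow>
    f \<in> (\<Pi>\<^sub>E v\<in>V. L v) \<and> g \<in> (\<Pi>\<^sub>E v\<in>V. L v) \<and>
    image_mset f (mset_set V) = image_mset g (mset_set V)"
proof -
  have "(\<exists>\<pi>. bij_betw \<pi> V V \<and> (\<forall>v\<in>V. f v = g (\<pi> v))) \<longleftrightarrow>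
      image_mset f (mset_set V) = image_mset g (mset_set V)" (is "?l \<longleftrightarrow> ?r")
  proof
    assume ?l
    then obtain \<pi> where \<pi>: "bij_betw \<pi> V V" "\<forall>v\<in>V. f v = g (\<pi> v)" by blast
    have "image_mset f (mset_set V) = image_mset g (image_mset \<pi> (mset_set V))"
      using \<pi>(2) assms by (auto simp: multiset.map_comp intro!: image_mset_cong)
    also have "image_mset \<pi> (mset_set V) = mset_set V"
      using \<pi>(1) by (simp add: bij_betw_def image_mset_mset_set)
    finally show ?r .
  next
    assume ?r
    then obtain p where "p permutes V" "\<forall>v\<in>V. f v = g (p v)"
      using image_mset_eq_implies_permutes[OF assms] by blast
    then show ?l by (blast dest: permutes_imp_bij)
  qed
  then show ?thesis
    by (simp add: coloring_equiv_def proper_list_colorings_edgeless graph_automorphism_def)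
      (simp add: edgeless_graph_def)
qed

lemma unlabeled_list_colorings_edgeless:
  assumes "finite V"
  shows "unlabeled_list_colorings (edgeless_graph V) L = card (color_multisets V L)"
proof -
  let ?P = "\<Pi>\<^sub>E v\<in>V. L v" and ?m = "\<lambda>f. image_mset f (mset_set V)"
  let ?fiber = "\<lambda>M. {g \<in> ?P. ?m g = M}"
  have "?P // coloring_equiv (edgeless_graph V) L = ?fiber ` color_multisets V L"
  proof -
    have "coloring_equiv (edgeless_graph V) L `` {f} = ?fiber (?m f)" if "f \<in> ?P" for f
      using that by (auto simp: coloring_equiv_edgeless_iff[OF assms])
    then show ?thesis
      unfolding color_multisets_def image_image quotient_def UNION_singleton_eq_range
      by (rule image_cong[OF refl])
  qed
  moreover have "inj_on ?fiber (color_multisets V L)"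
    unfolding color_multisets_def by (rule inj_onI) blast
  ultimately show ?thesis
    by (simp add: unlabeled_list_colorings_def proper_list_colorings_edgeless card_image)
qed

theorem mainTheorem2:
  fixes k n :: nat and V :: "'a set"
  assumes "k > 0" and "n > 0"
    and "finite V" and "card V = n"
  shows "unlabeled_list_color_function (edgeless_graph V) k = unlabeled_colorings (edgeless_graph V) k
    \<and> unlabeled_colorings (edgeless_graph V) k = (k + n - 1) choose n"
proof -
  let ?G = "edgeless_graph V"
  have const: "unlabeled_colorings ?G k = (k + n - 1) choose n"
    using assms(3,4)
    by (simp add: unlabeled_colorings_def unlabeled_list_colorings_edgeless
        color_multisets_const card_multisets_of_size)
  have "unlabeled_list_color_function ?G k = (k + n - 1) choose n"
    unfolding unlabeled_list_color_function_def
  proof (rule Least_equality)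
    have "k_assignment ?G k (\<lambda>_. {1..k})" by (simp add: k_assignment_def)
    then show "\<exists>L :: 'a \<Rightarrow> nat set. k_assignment ?G k L \<and>
        (k + n - 1) choose n = unlabeled_list_colorings ?G L"
      using const unfolding unlabeled_colorings_def by metis
  next
    fix m assume "\<exists>L :: 'a \<Rightarrow> nat set. k_assignment ?G k L \<and> m = unlabeled_list_colorings ?G L"
    then obtain L :: "'a \<Rightarrow> nat set" where
      L: "k_assignment ?G k L" "m = unlabeled_list_colorings ?G L" by blast
    have "finite (L v) \<and> k \<le> card (L v)" if "v \<in> V" for v
      using L(1) that by (simp add: k_assignment_def edgeless_graph_def)
    then have "(k + n - 1) choose n \<le> card (color_multisets V L)"
      by (rule card_color_multisets_ge[OF assms(3,4)])
    then show "(k + n - 1) choose n \<le> m"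
      by (simp only: L(2) unlabeled_list_colorings_edgeless[OF assms(3)])
  qed
  with const show ?thesis by simp
qed

end
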